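(* Consider the forward-Euler nodal DG scheme with positivity-preserving limiter for the two-dimensional Euler equations with gravity, $\mathbf U_h^{n+1}=\Pi_h^{2D}(\mathbf U_h^{EF})$, $\mathbf U_h^{EF}=\mathbf U_h^n+\Delta t\,\mathcal L_h(\mathbf U_h^n)$, where for all cells $(i,j)$ and $0\le i_1,j_1\le k$ the nodal values of $\mathcal L_h(\mathbf U_h)$ are $$\begin{aligned}\mathcal L_h(\mathbf U_h)_{i_1,j_1}^{i,j}=&-\frac{2}{\Delta x}\sum_{l=0}^k2D_{i_1,l}\mathbf F^S(\mathbf U_{i_1,j_1}^{i,j},\mathbf U_{l,j_1}^{i,j})+\frac2{\Delta x}\frac{\tau_{i_1}}{\omega_{i_1}}\left(\mathbf F(\mathbf U_{i_1,j_1}^{i,j})-\mathbf F_{i_1,j_1}^{*,i,j}\right)\\&-\frac{2}{\Delta y}\sum_{l=0}^k2D_{j_1,l}\mathbf G^S(\mathbf U_{i_1,j_1}^{i,j},\mathbf U_{i_1,l}^{i,j})+\frac2{\Delta y}\frac{\tau_{j_1}}{\omega_{j_1}}\left(\mathbf G(\mathbf U_{i_1,j_1}^{i,j})-\mathbf G_{i_1,j_1}^{*,i,j}\right)+\mathbf S_{i_1,j_1}^{i,j},\end{aligned}$$ with (omitting the indices $i,j,i_1,j_1$) $\mathbf S=\left(0,\frac2{\Delta x}\rho\Theta,\frac2{\Delta y}\rho\Xi,\frac2{\Delta x}m\Theta+\frac2{\Delta y}n\Xi\right)^T$, $$\Theta_{i_1,j_1}^{i,j}=\frac1{\rho_{i_1,j_1}^{e,i,j}}\sum_{l=0}^k2D_{i_1,l}F_2^S(\mathbf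 U_{i_1,j_1}^{e,i,j},\mathbf U_{l,j_1}^{e,i,j}),\qquad \Xi_{i_1,j_1}^{i,j}=\frac1{\rho_{i_1,j_1}^{e,i,j}}\sum_{l=0}^k2D_{j_1,l}G_3^S(\mathbf U_{i_1,l}^{e,i,j},\mathbf U_{i_1,j_1}^{e,i,j}),$$ and all notation as in the context. Assume $\mathbf U_{i_1,j_1}^{i,j,n}\in\mathscr G$ at all Gauss–Lobatto quadrature points. Then the cell averages satisfy $\bar{\mathbf U}^{i,j,n+1}\in\mathscr G$ under the time step restriction $$\frac{\Delta t}{\Delta x}<\min\left\{\frac{\omega_0}{8\alpha_{x,0}},\ \min\left\{\frac1{4|\Theta_{i_1,j_1}^{i,j}|}\sqrt{\frac1{2(\gamma-1)\beta_{i_1,j_1}^{i,j}}}\right\}\right\},\qquad \alpha_{x,0}=\max_\Omega\{|u|+c\},$$ $$\frac{\Delta t}{\Delta y}<\min\left\{\frac{\omega_0}{8\alpha_{y,0}},\ \min\left\{\frac1{4|\Xi_{i_1,j_1}^{i,j}|}\sqrt{\frac1{2(\gamma-1)\beta_{i_1,j_1}^{i,j}}}\right\}\right\},\qquad \alpha_{y,0}=\max_\Omega\{|v|+c\},$$ where the inner minima are over all $i,j,i_1,j_1$, $\beta_{i_1,j_1}^{i,j}=\rho_{i_1,j_1}^{i,j,n}/(2p_{i_1,j_1}^{i,j,n})$, $\Omega$ is the domain, and $u$, $v$, $c$ are the velocity components and sound speed of the numerical solution at time level $n$.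
   Context: Equations: $\mathbf U_t+\mathbf F(\mathbf U)_x+\mathbf G(\mathbf U)_y=\mathbf S(\mathbf U,x,y)$ with $\mathbf U=(\rho,m,n,\mathcal E)^T$, $m=\rho u$, $n=\rho v$ (the superscript $n$ elsewhere denotes the time level), $\mathbf F=(m,\rho u^2+p,\rho uv,u(\mathcal E+p))^T$, $\mathbf G=(n,\rho uv,\rho v^2+p,v(\mathcal E+p))^T$, $\mathbf S=(0,-\rho\phi_x,-\rho\phi_y,-m\phi_x-n\phi_y)^T$, $\phi=\phi(x,y)$ a given time-independent potential, $\mathcal E=\frac p{\gamma-1}+\frac12\rho(u^2+v^2)$, $\gamma=1.4$, $c=\sqrt{\gamma p/\rho}$. Admissible set: $\mathscr G=\{\mathbf U:\rho>0,\ p>0\}$ (convex). $\mathbf U^e$ is a given $\mathscr G$-valued hydrostatic steady state on the domain (zero velocity, $\nabla p^e=-\rho^e\nabla\phi$). Mesh: the rectangular domain $\Omega$ is divided into $N_x\times N_y$ uniform rectangular cells $K_{ij}$ of size $\Delta x\times\Delta y$ with centers $(x_i,y_j)$. Let $-1=X_0<\dots<X_k=1$ be the $k+1$ Gauss–Lobatto points on $[-1,1]$ with weights $\omega_l$ (so $\sum_l\omega_l=2$), $Y_l=X_l$, $L_l$ the Lagrange basis with $L_l(X_j)=\delta_{lj}$, $D_{jl}=L_l'(X_j)$, and $\tau_0=-1$, $\tau_k=1$, $\tau_l=0$ for $0<l<k$. $\mathbf U_{i_1,j_1}^{i,j}$ is the nodal value in $K_{ij}$ at $(x_i+\frac{\Delta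 x}2X_{i_1},\,y_j+\frac{\Delta y}2Y_{j_1})$; $\mathbf U_{i_1,j_1}^{e,i,j}$, $\rho_{i_1,j_1}^{e,i,j}$ are the values of $\mathbf U^e$, $\rho^e$ there. Cell average: $\bar{\mathbf U}^{i,j}=\sum_{i_1,j_1=0}^k\frac{\omega_{i_1}\omega_{j_1}}4\mathbf U_{i_1,j_1}^{i,j}$. Interface fluxes: $\mathbf F^{*,i,j}_{0,j_1}=\hat{\mathbf F}(\mathbf U^{i-1,j}_{k,j_1},\mathbf U^{i,j}_{0,j_1})$, $\mathbf F^{*,i,j}_{k,j_1}=\hat{\mathbf F}(\mathbf U^{i,j}_{k,j_1},\mathbf U^{i+1,j}_{0,j_1})$, zero for $0<i_1<k$; $\mathbf G^{*,i,j}_{i_1,0}=\hat{\mathbf G}(\mathbf U^{i,j-1}_{i_1,k},\mathbf U^{i,j}_{i_1,0})$, $\mathbf G^{*,i,j}_{i_1,k}=\hat{\mathbf G}(\mathbf U^{i,j}_{i_1,k},\mathbf U^{i,j+1}_{i_1,0})$, zero for $0<j_1<k$. Exterior states at the domain boundary are given by the boundary conditions and, like all states, lie in $\mathscr G$. $\hat{\mathbf F}(\mathbf U_L,\mathbf U_R)=\frac12(\mathbf F(\mathbf U_L)+\mathbf F(\mathbf U_R))-\frac\alpha2(\mathbf U_R-\mathbf U_L)$ is the (entropy stable) Lax–Friedrichs flux with $\alpha=\max\{|u_L|+c_L,|u_R|+c_R,\alpha^{RRF}(\mathbf U_L,\mathbf U_R)\}$, $\alpha^{RRF}$ the two-rarefaction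 estimate of the maximal wave speed of the Riemann problem in the $x$ direction; $\hat{\mathbf G}$ is the analogue with $\mathbf G$, $v$ in place of $\mathbf F$, $u$. $\mathbf F^S,\mathbf G^S$ are entropy conservative fluxes: consistent with $\mathbf F$, $\mathbf G$ (i.e. $\mathbf F^S(\mathbf U,\mathbf U)=\mathbf F(\mathbf U)$, $\mathbf G^S(\mathbf U,\mathbf U)=\mathbf G(\mathbf U)$), symmetric in their arguments, with $(\mathbf V_R-\mathbf V_L)^T\mathbf F^S(\mathbf U_L,\mathbf U_R)=(\rho u)_R-(\rho u)_L$ and $(\mathbf V_R-\mathbf V_L)^T\mathbf G^S(\mathbf U_L,\mathbf U_R)=(\rho v)_R-(\rho v)_L$, where $\mathbf V=\left(\frac{\gamma-s}{\gamma-1}-\frac{\rho(u^2+v^2)}{2p},\frac{\rho u}p,\frac{\rho v}p,-\frac\rho p\right)^T$, $s=\ln(p\rho^{-\gamma})$. Limiter $\Pi_h^{2D}$: in each cell (cell indices omitted), over all nodes $q=(i_1,j_1)$, $$\tilde\rho_q^{EF}=(1-\theta^{(1)})\bar\rho^{EF}+\theta^{(1)}\rho_q^{EF},\qquad \mathbf U_q^{n+1}=(1-\theta^{(2)})\bar{\mathbf U}^{EF}+\theta^{(2)}\widetilde{\mathbf U}_q^{EF},$$ where $\widetilde{\mathbf U}_q^{EF}$ is $\mathbf U_q^{EF}$ with density replaced by $\tilde\rho_q^{EF}$, $\theta^{(1)},\theta^{(2)}\in[0,1]$, $\theta^{(1)}=\min\left\{\frac{\bar\rho^{EF}-\varepsilon}{\bar\rho^{EF}-\min_q\rho_q^{EF}},1\right\}$,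 $\theta^{(2)}=\min_qt_q$, with $t_q=1$ if $p(\widetilde{\mathbf U}_q^{EF})\ge\varepsilon$ and otherwise $t_q$ solving $p\left((1-t)\bar{\mathbf U}^{EF}+t\,\widetilde{\mathbf U}_q^{EF}\right)=\varepsilon$; $\varepsilon=10^{-13}$.
   Formalization: The maxima α_{x,0}, α_{y,0} also include the Lax–Friedrichs speeds α (with the two-rarefaction estimate) at all cell interfaces, boundary ones included; with max{|u|+c} alone the claim fails, as α^RRF can be far larger (e.g. two colliding streams) and make the mean density negative. *)

theory Defs
  imports "HOL-Analysis.Analysis" "HOL-Computational_Algebra.Polynomial"
begin

section \<open>Euler equations\<close>

text \<open>A conservative state is \<open>(\<rho>, m, n, E)\<close> with \<open>m = \<rho> u\<close> and \<open>n = \<rho> v\<close>.\<close>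

type_synonym state = "real ^ 4"

lemma vector_4 [simp]:
  fixes a b c d :: "'a::zero"
  shows "(vector [a, b, c, d] :: 'a ^ 4) $ 1 = a"
    and "(vector [a, b, c, d] :: 'a ^ 4) $ 2 = b"
    and "(vector [a, b, c, d] :: 'a ^ 4) $ 3 = c"
    and "(vector [a, b, c, d] :: 'a ^ 4) $ 4 = d"
  unfolding vector_def by simp_all

definition gas_gamma :: real where
  "gas_gamma = 1.4"

definition dens :: "state \<Rightarrow> real" where
  "dens U = U $ 1"

definition velx :: "state \<Rightarrow> real" where
  "velx U = U $ 2 / U $ 1"

definition vely :: "state \<Rightarrow> real" where
  "vely U = U $ 3 / U $ 1"

definition pressure :: "state \<Rightarrow> real" where
  "pressure U = (gas_gamma - 1) * (U $ 4 - dens U * ((velx U)\<^sup>2 + (vely U)\<^sup>2) / 2)"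

definition sound :: "state \<Rightarrow> real" where
  "sound U = sqrt (gas_gamma * pressure U / dens U)"

definition admissible :: "state set" where
  "admissible = {U. dens U > 0 \<and> pressure U > 0}"

definition flux_x :: "state \<Rightarrow> state" where
  "flux_x U = vector [U $ 2, dens U * (velx U)\<^sup>2 + pressure U, dens U * velx U * vely U,
     velx U * (U $ 4 + pressure U)]"

definition flux_y :: "state \<Rightarrow> state" where
  "flux_y U = vector [U $ 3, dens U * velx U * vely U, dens U * (vely U)\<^sup>2 + pressure U,
     vely U * (U $ 4 + pressure U)]"

definition phys_entropy :: "state \<Rightarrow> real" where
  "phys_entropy U = ln (pressure U * dens U powr (- gas_gamma))"

definition entropy_var :: "state \<Rightarrow> state" where
  "entropy_var U = vector
     [(gas_gamma - phys_entropy U) / (gas_gamma - 1)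
        - dens U * ((velx U)\<^sup>2 + (vely U)\<^sup>2) / (2 * pressure U),
      dens U * velx U / pressure U,
      dens U * vely U / pressure U,
      - dens U / pressure U]"

definition entropy_conservative_x :: "(state \<Rightarrow> state \<Rightarrow> state) \<Rightarrow> bool" where
  "entropy_conservative_x FS \<longleftrightarrow>
     (\<forall>U\<in>admissible. FS U U = flux_x U) \<and>
     (\<forall>UL\<in>admissible. \<forall>UR\<in>admissible. FS UL UR = FS UR UL \<and>
        (entropy_var UR - entropy_var UL) \<bullet> FS UL UR
          = dens UR * velx UR - dens UL * velx UL)"

definition entropy_conservative_y :: "(state \<Rightarrow> state \<Rightarrow> state) \<Rightarrow> bool" where
  "entropy_conservative_y GS \<longleftrightarrow>
     (\<forall>U\<in>admissible. GS U U = flux_y U) \<and>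
     (\<forall>UL\<in>admissible. \<forall>UR\<in>admissible. GS UL UR = GS UR UL \<and>
        (entropy_var UR - entropy_var UL) \<bullet> GS UL UR
          = dens UR * vely UR - dens UL * vely UL)"

definition hydrostatic_on ::
  "(real \<times> real) set \<Rightarrow> (real \<times> real \<Rightarrow> real) \<Rightarrow> (real \<times> real \<Rightarrow> state) \<Rightarrow> bool" where
  "hydrostatic_on \<Omega> \<phi> Ue \<longleftrightarrow>
     (\<forall>z\<in>\<Omega>. Ue z \<in> admissible \<and> velx (Ue z) = 0 \<and> vely (Ue z) = 0 \<and>
        (\<exists>D. (\<phi> has_derivative D) (at z within \<Omega>) \<and>
             ((\<lambda>z'. pressure (Ue z')) has_derivative (\<lambda>h. - dens (Ue z) * D h))
               (at z within \<Omega>)))"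


section \<open>Lax--Friedrichs fluxes\<close>

text \<open>
  Two-rarefaction estimate. The star pressure is the exact one if both acoustic waves are
  rarefactions (\<open>0\<close> if they generate a vacuum, hence the truncation), and the extreme wave
  speeds are \<open>u\<^sub>L - c\<^sub>L q\<^sub>L\<close> and \<open>u\<^sub>R + c\<^sub>R q\<^sub>R\<close> with the shock factor
  \<open>q = sqrt (1 + (\<gamma> + 1) / (2 \<gamma>) (p\<^sup>* / p - 1))\<close> wherever \<open>p\<^sup>* > p\<close>, and \<open>q = 1\<close> otherwise.
  The arguments \<open>uL\<close>, \<open>uR\<close> are the velocities normal to the interface.
\<close>

definition rrf_pressure :: "real \<Rightarrow> real \<Rightarrow> real \<Rightarrow> real \<Rightarrow> real \<Rightarrow> real \<Rightarrow> real" where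
  "rrf_pressure uL cL pL uR cR pR =
     (max 0 (cL + cR - (gas_gamma - 1) / 2 * (uR - uL)) /
       (cL * pL powr (- (gas_gamma - 1) / (2 * gas_gamma))
        + cR * pR powr (- (gas_gamma - 1) / (2 * gas_gamma))))
     powr (2 * gas_gamma / (gas_gamma - 1))"

definition shock_factor :: "real \<Rightarrow> real \<Rightarrow> real" where
  "shock_factor pstar p =
     sqrt (1 + (gas_gamma + 1) / (2 * gas_gamma) * max 0 (pstar / p - 1))"

definition rrf_speed :: "real \<Rightarrow> real \<Rightarrow> real \<Rightarrow> real \<Rightarrow> real \<Rightarrow> real \<Rightarrow> real" where
  "rrf_speed uL cL pL uR cR pR =
     (let pstar = rrf_pressure uL cL pL uR cR pR
      in max \<bar>uL - cL * shock_factor pstar pL\<bar> \<bar>uR + cR * shock_factor pstar pR\<bar>)"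

definition lf_speed_x :: "state \<Rightarrow> state \<Rightarrow> real" where
  "lf_speed_x UL UR = Max {\<bar>velx UL\<bar> + sound UL, \<bar>velx UR\<bar> + sound UR,
     rrf_speed (velx UL) (sound UL) (pressure UL) (velx UR) (sound UR) (pressure UR)}"

definition lf_speed_y :: "state \<Rightarrow> state \<Rightarrow> real" where
  "lf_speed_y UL UR = Max {\<bar>vely UL\<bar> + sound UL, \<bar>vely UR\<bar> + sound UR,
     rrf_speed (vely UL) (sound UL) (pressure UL) (vely UR) (sound UR) (pressure UR)}"

definition lf_flux_x :: "state \<Rightarrow> state \<Rightarrow> state" where
  "lf_flux_x UL UR =
     (1 / 2) *\<^sub>R (flux_x UL + flux_x UR) - (lf_speed_x UL UR / 2) *\<^sub>R (UR - UL)"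

definition lf_flux_y :: "state \<Rightarrow> state \<Rightarrow> state" where
  "lf_flux_y UL UR =
     (1 / 2) *\<^sub>R (flux_y UL + flux_y UR) - (lf_speed_y UL UR / 2) *\<^sub>R (UR - UL)"


section \<open>Quadrature and mesh\<close>

text \<open>
  The \<open>(k + 1)\<close>-point Gauss--Lobatto rule on \<open>[-1, 1]\<close>: both endpoints are nodes and the rule
  is exact up to degree \<open>2 k - 1\<close>. This determines the nodes and the weights.
\<close>

definition gauss_lobatto :: "nat \<Rightarrow> (nat \<Rightarrow> real) \<Rightarrow> (nat \<Rightarrow> real) \<Rightarrow> bool" where
  "gauss_lobatto k X w \<longleftrightarrow>
     k \<ge> 1 \<and> X 0 = -1 \<and> X k = 1 \<and> strict_mono_on {..k} X \<and>
     (\<forall>q :: real poly. degree q \<le> 2 * k - 1 \<longrightarrow>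
        (\<Sum>l\<le>k. w l * poly q (X l)) = integral {-1..1} (poly q))"

definition lagrange_basis :: "nat \<Rightarrow> (nat \<Rightarrow> real) \<Rightarrow> nat \<Rightarrow> real poly" where
  "lagrange_basis k X l = (\<Prod>m\<in>{..k} - {l}. smult (1 / (X l - X m)) [:- X m, 1:])"

definition diff_matrix :: "nat \<Rightarrow> (nat \<Rightarrow> real) \<Rightarrow> nat \<Rightarrow> nat \<Rightarrow> real" where
  "diff_matrix k X j l = poly (pderiv (lagrange_basis k X l)) (X j)"

definition bdry_sign :: "nat \<Rightarrow> nat \<Rightarrow> real" where
  "bdry_sign k l = (if l = 0 then -1 else if l = k then 1 else 0)"

text \<open>The domain has lower left corner \<open>(xa, ya)\<close>.\<close>

definition rect_domain ::
  "real \<Rightarrow> real \<Rightarrow> real \<Rightarrow> real \<Rightarrow> nat \<Rightarrow> nat \<Rightarrow> (real \<times> real) set" where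
  "rect_domain xa ya dx dy Nx Ny = {xa..xa + real Nx * dx} \<times> {ya..ya + real Ny * dy}"

text \<open>
  Nodal values are indexed as \<open>U i j i1 j1\<close>, with the cell \<open>(i, j)\<close> first and the node \<open>(i1, j1)\<close>
  in it second. Cells of the mesh have \<open>1 \<le> i \<le> Nx\<close>, \<open>1 \<le> j \<le> Ny\<close>. Exterior states at the domain
  boundary are stored as traces of the fictitious cells with \<open>i = 0\<close>, \<open>i = Nx + 1\<close>, \<open>j = 0\<close> or
  \<open>j = Ny + 1\<close>.
\<close>

type_synonym cell_field = "nat \<Rightarrow> nat \<Rightarrow> state"
type_synonym nodal_field = "nat \<Rightarrow> nat \<Rightarrow> cell_field"

definition nodal_values ::
  "real \<Rightarrow> real \<Rightarrow> real \<Rightarrow> real \<Rightarrow> (nat \<Rightarrow> real) \<Rightarrow> (real \<times> real \<Rightarrow> state) \<Rightarrow> nodal_field" where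
  "nodal_values xa ya dx dy X f i j i1 j1 =
     f (xa + (real i - 1 / 2) * dx + dx / 2 * X i1, ya + (real j - 1 / 2) * dy + dy / 2 * X j1)"

definition cell_average :: "nat \<Rightarrow> (nat \<Rightarrow> real) \<Rightarrow> cell_field \<Rightarrow> state" where
  "cell_average k w V = (\<Sum>i1\<le>k. \<Sum>j1\<le>k. (w i1 * w j1 / 4) *\<^sub>R V i1 j1)"

definition exterior_admissible :: "nat \<Rightarrow> nat \<Rightarrow> nat \<Rightarrow> nodal_field \<Rightarrow> bool" where
  "exterior_admissible k Nx Ny U \<longleftrightarrow>
     (\<forall>j\<in>{1..Ny}. \<forall>j1\<le>k. U 0 j k j1 \<in> admissible \<and> U (Nx + 1) j 0 j1 \<in> admissible) \<and>
     (\<forall>i\<in>{1..Nx}. \<forall>i1\<le>k. U i 0 i1 k \<in> admissible \<and> U i (Ny + 1) i1 0 \<in> admissible)"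

text \<open>
  Maximal wave speeds over the domain. The maximum of \<open>|u| + c\<close> runs over the Gauss--Lobatto
  nodes. At a cell interface the numerical solution has two traces, and the wave speed there is
  the one of the numerical flux; it dominates \<open>|u| + c\<close> of both traces, the exterior ones
  included, and may exceed both by virtue of the two-rarefaction estimate.
\<close>

definition max_speed_x :: "nat \<Rightarrow> nat \<Rightarrow> nat \<Rightarrow> nodal_field \<Rightarrow> real" where
  "max_speed_x k Nx Ny U = Max
     ({\<bar>velx (U i j i1 j1)\<bar> + sound (U i j i1 j1) | i j i1 j1.
         i \<in> {1..Nx} \<and> j \<in> {1..Ny} \<and> i1 \<le> k \<and> j1 \<le> k} \<union>
      {lf_speed_x (U i j k j1) (U (i + 1) j 0 j1) | i j j1.
         i \<in> {0..Nx} \<and> j \<in> {1..Ny} \<and> j1 \<le> k})"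

definition max_speed_y :: "nat \<Rightarrow> nat \<Rightarrow> nat \<Rightarrow> nodal_field \<Rightarrow> real" where
  "max_speed_y k Nx Ny U = Max
     ({\<bar>vely (U i j i1 j1)\<bar> + sound (U i j i1 j1) | i j i1 j1.
         i \<in> {1..Nx} \<and> j \<in> {1..Ny} \<and> i1 \<le> k \<and> j1 \<le> k} \<union>
      {lf_speed_y (U i j i1 k) (U i (j + 1) i1 0) | i j i1.
         i \<in> {1..Nx} \<and> j \<in> {0..Ny} \<and> i1 \<le> k})"


section \<open>The scheme\<close>

definition num_flux_x :: "nat \<Rightarrow> nodal_field \<Rightarrow> nodal_field" where
  "num_flux_x k U i j i1 j1 =
     (if i1 = 0 then lf_flux_x (U (i - 1) j k j1) (U i j 0 j1)
      else if i1 = k then lf_flux_x (U i j k j1) (U (i + 1) j 0 j1)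
      else 0)"

definition num_flux_y :: "nat \<Rightarrow> nodal_field \<Rightarrow> nodal_field" where
  "num_flux_y k U i j i1 j1 =
     (if j1 = 0 then lf_flux_y (U i (j - 1) i1 k) (U i j i1 0)
      else if j1 = k then lf_flux_y (U i j i1 k) (U i (j + 1) i1 0)
      else 0)"

definition Theta :: "nat \<Rightarrow> (nat \<Rightarrow> real) \<Rightarrow> (state \<Rightarrow> state \<Rightarrow> state) \<Rightarrow> nodal_field \<Rightarrow>
    nat \<Rightarrow> nat \<Rightarrow> nat \<Rightarrow> nat \<Rightarrow> real" where
  "Theta k X FS Ue i j i1 j1 = 1 / dens (Ue i j i1 j1) *
     (\<Sum>l\<le>k. 2 * diff_matrix k X i1 l * FS (Ue i j i1 j1) (Ue i j l j1) $ 2)"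

definition Xi :: "nat \<Rightarrow> (nat \<Rightarrow> real) \<Rightarrow> (state \<Rightarrow> state \<Rightarrow> state) \<Rightarrow> nodal_field \<Rightarrow>
    nat \<Rightarrow> nat \<Rightarrow> nat \<Rightarrow> nat \<Rightarrow> real" where
  "Xi k X GS Ue i j i1 j1 = 1 / dens (Ue i j i1 j1) *
     (\<Sum>l\<le>k. 2 * diff_matrix k X j1 l * GS (Ue i j i1 l) (Ue i j i1 j1) $ 3)"

definition source_term :: "real \<Rightarrow> real \<Rightarrow> real \<Rightarrow> real \<Rightarrow> state \<Rightarrow> state" where
  "source_term dx dy \<theta> \<xi> U =
     vector [0, 2 / dx * dens U * \<theta>, 2 / dy * dens U * \<xi>,
       2 / dx * U $ 2 * \<theta> + 2 / dy * U $ 3 * \<xi>]"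

definition dg_operator ::
  "nat \<Rightarrow> (nat \<Rightarrow> real) \<Rightarrow> (nat \<Rightarrow> real) \<Rightarrow> real \<Rightarrow> real \<Rightarrow>
   (state \<Rightarrow> state \<Rightarrow> state) \<Rightarrow> (state \<Rightarrow> state \<Rightarrow> state) \<Rightarrow>
   nodal_field \<Rightarrow> nodal_field \<Rightarrow> nodal_field" where
  "dg_operator k X w dx dy FS GS Ue U i j i1 j1 =
     - ((2 / dx) *\<^sub>R (\<Sum>l\<le>k. (2 * diff_matrix k X i1 l) *\<^sub>R FS (U i j i1 j1) (U i j l j1)))
     + (2 / dx * (bdry_sign k i1 / w i1)) *\<^sub>R (flux_x (U i j i1 j1) - num_flux_x k U i j i1 j1)
     - (2 / dy) *\<^sub>R (\<Sum>l\<le>k. (2 * diff_matrix k X j1 l) *\<^sub>R GS (U i j i1 j1) (U i j i1 l))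
     + (2 / dy * (bdry_sign k j1 / w j1)) *\<^sub>R (flux_y (U i j i1 j1) - num_flux_y k U i j i1 j1)
     + source_term dx dy (Theta k X FS Ue i j i1 j1) (Xi k X GS Ue i j i1 j1) (U i j i1 j1)"

definition forward_euler ::
  "nat \<Rightarrow> (nat \<Rightarrow> real) \<Rightarrow> (nat \<Rightarrow> real) \<Rightarrow> real \<Rightarrow> real \<Rightarrow> real \<Rightarrow>
   (state \<Rightarrow> state \<Rightarrow> state) \<Rightarrow> (state \<Rightarrow> state \<Rightarrow> state) \<Rightarrow>
   nodal_field \<Rightarrow> nodal_field \<Rightarrow> nodal_field" where
  "forward_euler k X w dx dy dt FS GS Ue U i j i1 j1 =
     U i j i1 j1 + dt *\<^sub>R dg_operator k X w dx dy FS GS Ue U i j i1 j1"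

definition lim_eps :: real where
  "lim_eps = 1 / 10 ^ 13"

text \<open>
  If all nodal densities of a cell coincide, the quotient below has denominator \<open>0\<close>; then
  \<open>scaled_state\<close> does not depend on \<open>lim_theta1\<close>.
\<close>

definition lim_theta1 :: "nat \<Rightarrow> (nat \<Rightarrow> real) \<Rightarrow> cell_field \<Rightarrow> real" where
  "lim_theta1 k w V =
     (let rbar = dens (cell_average k w V);
          rmin = Min {dens (V i1 j1) | i1 j1. i1 \<le> k \<and> j1 \<le> k}
      in min ((rbar - lim_eps) / (rbar - rmin)) 1)"

definition scaled_state :: "nat \<Rightarrow> (nat \<Rightarrow> real) \<Rightarrow> cell_field \<Rightarrow> cell_field" where
  "scaled_state k w V i1 j1 =
     vector [(1 - lim_theta1 k w V) * dens (cell_average k w V)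
               + lim_theta1 k w V * dens (V i1 j1),
             V i1 j1 $ 2, V i1 j1 $ 3, V i1 j1 $ 4]"

definition lim_t :: "nat \<Rightarrow> (nat \<Rightarrow> real) \<Rightarrow> cell_field \<Rightarrow> nat \<Rightarrow> nat \<Rightarrow> real" where
  "lim_t k w V i1 j1 =
     (if pressure (scaled_state k w V i1 j1) \<ge> lim_eps then 1
      else SOME t. t \<in> {0..1} \<and>
        pressure ((1 - t) *\<^sub>R cell_average k w V + t *\<^sub>R scaled_state k w V i1 j1) = lim_eps)"

definition lim_theta2 :: "nat \<Rightarrow> (nat \<Rightarrow> real) \<Rightarrow> cell_field \<Rightarrow> real" where
  "lim_theta2 k w V = Min {lim_t k w V i1 j1 | i1 j1. i1 \<le> k \<and> j1 \<le> k}"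

definition pp_limiter :: "nat \<Rightarrow> (nat \<Rightarrow> real) \<Rightarrow> cell_field \<Rightarrow> cell_field" where
  "pp_limiter k w V i1 j1 =
     (1 - lim_theta2 k w V) *\<^sub>R cell_average k w V + lim_theta2 k w V *\<^sub>R scaled_state k w V i1 j1"

definition dg_step ::
  "nat \<Rightarrow> (nat \<Rightarrow> real) \<Rightarrow> (nat \<Rightarrow> real) \<Rightarrow> real \<Rightarrow> real \<Rightarrow> real \<Rightarrow>
   (state \<Rightarrow> state \<Rightarrow> state) \<Rightarrow> (state \<Rightarrow> state \<Rightarrow> state) \<Rightarrow>
   nodal_field \<Rightarrow> nodal_field \<Rightarrow> nodal_field" where
  "dg_step k X w dx dy dt FS GS Ue U i j =
     pp_limiter k w (forward_euler k X w dx dy dt FS GS Ue U i j)"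

definition beta :: "state \<Rightarrow> real" where
  "beta U = dens U / (2 * pressure U)"

text \<open>
  The inner minimum over the nodes of the time step restriction, as a bound by each of its
  members. A node with \<open>\<theta> = 0\<close> contributes \<open>+\<infinity>\<close>, i.e. no restriction; in HOL the quotient
  would be \<open>0\<close> there.
\<close>

definition source_cfl :: "nat \<Rightarrow> nat \<Rightarrow> nat \<Rightarrow> real \<Rightarrow> (nat \<Rightarrow> nat \<Rightarrow> nat \<Rightarrow> nat \<Rightarrow> real) \<Rightarrow>
    nodal_field \<Rightarrow> bool" where
  "source_cfl k Nx Ny r \<theta> U \<longleftrightarrow>
     (\<forall>i\<in>{1..Nx}. \<forall>j\<in>{1..Ny}. \<forall>i1\<le>k. \<forall>j1\<le>k. \<theta> i j i1 j1 \<noteq> 0 \<longrightarrow>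
        r < 1 / (4 * \<bar>\<theta> i j i1 j1\<bar>) * sqrt (1 / (2 * (gas_gamma - 1) * beta (U i j i1 j1))))"

end

theory Submission
  imports Defs
begin

text \<open>
  The limiter preserves the cell average, and by summation by parts the entropy conservative fluxes
  telescope to the endpoint fluxes. So the new cell average is a positive combination, over the
  nodes, of \<open>U / 2 + \<Delta>t S\<close> and of \<open>U / 4\<close> minus the Lax--Friedrichs face contribution in each
  direction. The source only shifts the velocity, so the first state is admissible as long as the
  kinetic energy of the shift is below the internal energy. The others are positive combinations
  of \<open>U\<close> and \<open>\<alpha> U \<plusminus> F(U)\<close>, which are admissible for \<open>\<alpha> \<ge> |u| + c\<close>. As the admissible set is
  a convex cone, this suffices.
\<close>


section \<open>The admissible set as a convex cone\<close>

text \<open>The internal energy is the minimum over \<open>(a, b)\<close> of the linear functionals below, attained at the velocity.\<close>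

lemma admissible_iff_linear:
  "U \<in> admissible \<longleftrightarrow>
     U $ 1 > 0 \<and> (\<forall>a b. U $ 4 - a * U $ 2 - b * U $ 3 + (a\<^sup>2 + b\<^sup>2) / 2 * U $ 1 > 0)"
proof (cases "U $ 1 > 0")
  case True
  define \<epsilon> where "\<epsilon> = U $ 4 - U $ 1 * ((velx U)\<^sup>2 + (vely U)\<^sup>2) / 2"
  have m: "U $ 2 = U $ 1 * velx U" "U $ 3 = U $ 1 * vely U"
    using True by (simp_all add: velx_def vely_def)
  have split: "U $ 4 - a * U $ 2 - b * U $ 3 + (a\<^sup>2 + b\<^sup>2) / 2 * U $ 1 =
      \<epsilon> + U $ 1 / 2 * ((a - velx U)\<^sup>2 + (b - vely U)\<^sup>2)" for a b
    unfolding \<epsilon>_def m by (simp add: power2_eq_square field_simps)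
  have "pressure U > 0 \<longleftrightarrow> \<epsilon> > 0"
    by (simp add: pressure_def gas_gamma_def dens_def \<epsilon>_def mult.commute)
  moreover have "\<epsilon> > 0 \<longleftrightarrow> (\<forall>a b. \<epsilon> + U $ 1 / 2 * ((a - velx U)\<^sup>2 + (b - vely U)\<^sup>2) > 0)"
  proof
    assume "\<epsilon> > 0"
    then show "\<forall>a b. \<epsilon> + U $ 1 / 2 * ((a - velx U)\<^sup>2 + (b - vely U)\<^sup>2) > 0"
      using True by (intro allI add_pos_nonneg) auto
  next
    assume "\<forall>a b. \<epsilon> + U $ 1 / 2 * ((a - velx U)\<^sup>2 + (b - vely U)\<^sup>2) > 0"
    from spec[OF spec[OF this, of "velx U"], of "vely U"] show "\<epsilon> > 0" by simp
  qed
  ultimately show ?thesis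
    unfolding split using True by (simp add: admissible_def dens_def)
qed (simp add: admissible_def dens_def)

text \<open>The pressure is nonlinear in the state, but every condition of
  \<open>admissible_iff_linear\<close> is linear and so passes to sums.\<close>

lemma admissible_add:
  assumes "U \<in> admissible" and "V \<in> admissible"
  shows "U + V \<in> admissible"
  unfolding admissible_iff_linear
proof (intro conjI allI)
  show "(U + V) $ 1 > 0"
    using assms by (simp add: admissible_iff_linear)
  fix a b
  have "(U $ 4 - a * U $ 2 - b * U $ 3 + (a\<^sup>2 + b\<^sup>2) / 2 * U $ 1) +
      (V $ 4 - a * V $ 2 - b * V $ 3 + (a\<^sup>2 + b\<^sup>2) / 2 * V $ 1) > 0"
    using assms unfolding admissible_iff_linear by (blast intro: add_pos_pos)
  then show "(U + V) $ 4 - a * (U + V) $ 2 - b * (U + V) $ 3 + (a\<^sup>2 + b\<^sup>2) / 2 * (U + V) $ 1 > 0"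
    by (simp add: algebra_simps add_divide_distrib)
qed

lemma admissible_scaleR:
  assumes "U \<in> admissible" and "r > 0"
  shows "r *\<^sub>R U \<in> admissible"
  unfolding admissible_iff_linear
proof (intro conjI allI)
  show "(r *\<^sub>R U) $ 1 > 0"
    using assms by (simp add: admissible_iff_linear)
  fix a b
  have "r * (U $ 4 - a * U $ 2 - b * U $ 3 + (a\<^sup>2 + b\<^sup>2) / 2 * U $ 1) > 0"
    using assms by (simp add: admissible_iff_linear)
  then show "(r *\<^sub>R U) $ 4 - a * (r *\<^sub>R U) $ 2 - b * (r *\<^sub>R U) $ 3
      + (a\<^sup>2 + b\<^sup>2) / 2 * (r *\<^sub>R U) $ 1 > 0"
    by (simp add: algebra_simps)
qed

lemma admissible_sum:
  assumes "finite A" and "A \<noteq> {}" and "\<And>x. x \<in> A \<Longrightarrow> f x \<in> admissible"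
  shows "sum f A \<in> admissible"
  using assms by (induction rule: finite_ne_induct) (simp_all add: admissible_add)

lemma cell_average_admissible:
  assumes "\<And>l. l \<le> k \<Longrightarrow> w l > 0"
    and "\<And>i1 j1. i1 \<le> k \<Longrightarrow> j1 \<le> k \<Longrightarrow> V i1 j1 \<in> admissible"
  shows "cell_average k w V \<in> admissible"
  unfolding cell_average_def
  by (intro admissible_sum admissible_scaleR) (auto intro: assms mult_pos_pos)


section \<open>Admissibility of the flux and source contributions\<close>

lemma admissibleI_split:
  assumes "U $ 1 = r" "r > 0" "U $ 2 = r * a" "U $ 3 = r * b"
    and "U $ 4 = e + r * (a\<^sup>2 + b\<^sup>2) / 2" "e > 0"
  shows "U \<in> admissible"
  using assms by (simp add: admissible_def dens_def pressure_def velx_def vely_def gas_gamma_def)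

lemma admissibleE_split:
  assumes "U \<in> admissible"
  obtains r a b p where "U $ 1 = r" "r > 0" "U $ 2 = r * a" "U $ 3 = r * b"
    "U $ 4 = p / (gas_gamma - 1) + r * (a\<^sup>2 + b\<^sup>2) / 2" "p > 0"
    "dens U = r" "velx U = a" "vely U = b" "pressure U = p"
proof (rule that[of "dens U" "velx U" "vely U" "pressure U"])
  show "U $ 4 = pressure U / (gas_gamma - 1) + dens U * ((velx U)\<^sup>2 + (vely U)\<^sup>2) / 2"
    by (simp add: pressure_def gas_gamma_def field_simps)
qed (use assms in \<open>auto simp: admissible_def dens_def velx_def vely_def\<close>)

lemma sound_pos: "U \<in> admissible \<Longrightarrow> sound U > 0"
  by (simp add: admissible_def sound_def gas_gamma_def)

text \<open>
  The quantity is the internal energy of \<open>\<alpha> U \<plusminus> F(U)\<close>, where \<open>s = \<alpha> \<plusminus> u\<close>.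
\<close>

lemma internal_energy_pos:
  assumes "r > 0" "p > 0" "s \<ge> sqrt (gas_gamma * p / r)"
  shows "s > 0" and "s * p / (gas_gamma - 1) - p\<^sup>2 / (2 * r * s) > 0"
proof -
  have "sqrt (gas_gamma * p / r) > 0"
    using assms by (simp add: gas_gamma_def)
  then show s: "s > 0" using assms by linarith
  have "(sqrt (gas_gamma * p / r))\<^sup>2 \<le> s\<^sup>2"
    using assms by (intro power_mono) (auto simp: gas_gamma_def)
  then have "gas_gamma * p / r \<le> s\<^sup>2"
    using assms by (simp add: gas_gamma_def)
  then have "1.4 * p \<le> s\<^sup>2 * r"
    using assms by (simp add: gas_gamma_def field_simps)
  \<comment> \<open>Cleared of denominators, the claim is this inequality times \<open>p\<close>,
    with \<open>0.4\<close> for \<open>gas_gamma - 1\<close>; the sound speed bound leaves ample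
    room.\<close>
  then have "0.4 * p < 2 * (s\<^sup>2 * r)" using assms by linarith
  then have "p * (0.4 * p) < p * (2 * (s\<^sup>2 * r))" using assms by (intro mult_strict_left_mono)
  then show "s * p / (gas_gamma - 1) - p\<^sup>2 / (2 * r * s) > 0"
    using assms s by (simp add: gas_gamma_def field_simps power2_eq_square)
qed

text \<open>The combination has density \<open>r * s\<close>; the pressure in the flux shifts the
  normal velocity by \<open>\<sigma> * p / (r * s)\<close> and leaves the tangential one alone. What
  remains of the energy is positive by \<open>internal_energy_pos\<close>.\<close>

lemma flux_x_admissible:
  assumes U: "U \<in> admissible" and \<alpha>: "\<alpha> \<ge> \<bar>velx U\<bar> + sound U" and \<sigma>: "\<sigma> = 1 \<or> \<sigma> = -1"
  shows "\<alpha> *\<^sub>R U + \<sigma> *\<^sub>R flux_x U \<in> admissible"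
proof -
  obtain r a b p where d: "U $ 1 = r" "r > 0" "U $ 2 = r * a" "U $ 3 = r * b"
    "U $ 4 = p / (gas_gamma - 1) + r * (a\<^sup>2 + b\<^sup>2) / 2" "p > 0"
    "dens U = r" "velx U = a" "vely U = b" "pressure U = p"
    using U by (rule admissibleE_split)
  define s where "s = \<alpha> + \<sigma> * a"
  have "s \<ge> sqrt (gas_gamma * p / r)"
    using \<alpha> \<sigma> d by (auto simp: s_def sound_def)
  note s = internal_energy_pos[OF \<open>r > 0\<close> \<open>p > 0\<close> this]
  have \<sigma>2: "\<sigma> * \<sigma> = 1" using \<sigma> by auto
  have \<alpha>s: "\<alpha> = s - \<sigma> * a" by (simp add: s_def)
  show ?thesis
  proof (rule admissibleI_split[where r = "r * s" and a = "a + \<sigma> * p / (r * s)" and b = b])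
    show "(\<alpha> *\<^sub>R U + \<sigma> *\<^sub>R flux_x U) $ 4 = (s * p / (gas_gamma - 1) - p\<^sup>2 / (2 * r * s))
        + r * s * ((a + \<sigma> * p / (r * s))\<^sup>2 + b\<^sup>2) / 2"
    proof -
      have "r * s * (a + \<sigma> * p / (r * s))\<^sup>2 = r * s * a\<^sup>2 + 2 * a * \<sigma> * p + (\<sigma> * \<sigma>) * p\<^sup>2 / (r * s)"
        using s d by (simp add: field_simps power2_eq_square)
      then show ?thesis
        unfolding \<alpha>s using s d \<sigma>2
        by (simp add: flux_x_def algebra_simps add_divide_distrib diff_divide_distrib)
    qed
  qed (use s d in \<open>simp_all add: flux_x_def \<alpha>s field_simps power2_eq_square\<close>)
qed

definition swap_axes :: "state \<Rightarrow> state" where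
  "swap_axes U = vector [U $ 1, U $ 3, U $ 2, U $ 4]"

lemma swap_axes_simps:
  "swap_axes U $ 1 = U $ 1" "swap_axes U $ 2 = U $ 3" "swap_axes U $ 3 = U $ 2"
  "swap_axes U $ 4 = U $ 4"
  by (simp_all add: swap_axes_def)

lemma swap_axes_gas:
  "dens (swap_axes U) = dens U" "velx (swap_axes U) = vely U" "vely (swap_axes U) = velx U"
  "pressure (swap_axes U) = pressure U" "sound (swap_axes U) = sound U"
  by (simp_all add: sound_def pressure_def dens_def velx_def vely_def swap_axes_simps add.commute)

lemma swap_axes_admissible_iff: "swap_axes U \<in> admissible \<longleftrightarrow> U \<in> admissible"
  by (simp add: admissible_def swap_axes_gas)

text \<open>Exchanging the axes turns one flux into the other,
  \<open>flux_x (swap_axes U) = swap_axes (flux_y U)\<close>, and preserves admissibility.\<close>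

lemma flux_y_admissible:
  assumes "U \<in> admissible" "\<alpha> \<ge> \<bar>vely U\<bar> + sound U" "\<sigma> = 1 \<or> \<sigma> = -1"
  shows "\<alpha> *\<^sub>R U + \<sigma> *\<^sub>R flux_y U \<in> admissible"
proof -
  have "\<alpha> *\<^sub>R swap_axes U + \<sigma> *\<^sub>R flux_x (swap_axes U) \<in> admissible"
    using assms by (intro flux_x_admissible) (simp_all add: swap_axes_gas swap_axes_admissible_iff)
  also have "\<alpha> *\<^sub>R swap_axes U + \<sigma> *\<^sub>R flux_x (swap_axes U) = swap_axes (\<alpha> *\<^sub>R U + \<sigma> *\<^sub>R flux_y U)"
    by (simp add: vec_eq_iff forall_4 swap_axes_simps swap_axes_gas flux_x_def flux_y_def algebra_simps)
  finally show ?thesis by (simp add: swap_axes_admissible_iff)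
qed

text \<open>
  Applied with \<open>\<sigma> = 1\<close> at a left face, where \<open>V\<close> is the inner and \<open>W\<close> the outer trace, and with
  \<open>\<sigma> = -1\<close> at a right face.
\<close>

lemma lax_friedrichs_admissible:
  assumes "V \<in> admissible" "\<alpha> *\<^sub>R V + \<sigma> *\<^sub>R FV \<in> admissible" "\<alpha> *\<^sub>R W + \<sigma> *\<^sub>R FW \<in> admissible"
    and "\<mu> > 0" "\<mu> * \<alpha> < 1 / 4" "\<sigma> = 1 \<or> \<sigma> = -1"
  shows "(1 / 4) *\<^sub>R V + (\<sigma> * \<mu>) *\<^sub>R
     ((1 / 2) *\<^sub>R (FW + FV) - (\<sigma> * \<alpha> / 2) *\<^sub>R (V - W)) \<in> admissible"
proof -
  \<comment> \<open>As \<open>\<sigma>\<close> squares to 1, the dissipation uses up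
    \<open>\<mu> * \<alpha> / 2\<close> of \<open>V\<close>, and pairing \<open>V\<close> with its
    own flux as much again; the rest is positive by \<open>\<mu> * \<alpha> < 1 / 4\<close>.\<close>
  have "(\<mu> / 2) *\<^sub>R (\<alpha> *\<^sub>R W + \<sigma> *\<^sub>R FW) + (\<mu> / 2) *\<^sub>R (\<alpha> *\<^sub>R V + \<sigma> *\<^sub>R FV)
      + (1 / 4 - \<mu> * \<alpha>) *\<^sub>R V \<in> admissible"
    by (rule admissible_add[OF admissible_add[OF admissible_scaleR admissible_scaleR] admissible_scaleR])
      (use assms in simp_all)
  moreover have "(\<mu> / 2) *\<^sub>R (\<alpha> *\<^sub>R W + \<sigma> *\<^sub>R FW) + (\<mu> / 2) *\<^sub>R (\<alpha> *\<^sub>R V + \<sigma> *\<^sub>R FV)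
      + (1 / 4 - \<mu> * \<alpha>) *\<^sub>R V =
      (1 / 4) *\<^sub>R V + (\<sigma> * \<mu>) *\<^sub>R ((1 / 2) *\<^sub>R (FW + FV) - (\<sigma> * \<alpha> / 2) *\<^sub>R (V - W))"
    using assms(6) by (auto simp: vec_eq_iff field_simps)
  ultimately show ?thesis by simp
qed

lemma lf_speed_x_ge:
  "lf_speed_x UL UR \<ge> \<bar>velx UL\<bar> + sound UL" "lf_speed_x UL UR \<ge> \<bar>velx UR\<bar> + sound UR"
  unfolding lf_speed_x_def by (intro Max_ge; simp)+

lemma lf_speed_y_ge:
  "lf_speed_y UL UR \<ge> \<bar>vely UL\<bar> + sound UL" "lf_speed_y UL UR \<ge> \<bar>vely UR\<bar> + sound UR"
  unfolding lf_speed_y_def by (intro Max_ge; simp)+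

text \<open>The face flux enters the right state and leaves the left one; a quarter of a nodal state
  is the share of one space direction.\<close>

lemma lf_flux_x_admissible:
  assumes "UL \<in> admissible" "UR \<in> admissible" "\<mu> > 0" "\<mu> * lf_speed_x UL UR < 1 / 4"
  shows "(1 / 4) *\<^sub>R UR + \<mu> *\<^sub>R lf_flux_x UL UR \<in> admissible"
    and "(1 / 4) *\<^sub>R UL - \<mu> *\<^sub>R lf_flux_x UL UR \<in> admissible"
proof -
  note flux = flux_x_admissible[OF assms(1) lf_speed_x_ge(1)[of UL UR]]
    flux_x_admissible[OF assms(2) lf_speed_x_ge(2)[of UR UL]]
  show "(1 / 4) *\<^sub>R UR + \<mu> *\<^sub>R lf_flux_x UL UR \<in> admissible"
    using lax_friedrichs_admissible[of UR "lf_speed_x UL UR" 1 "flux_x UR" UL "flux_x UL" \<mu>]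
      flux[of 1] assms by (simp add: lf_flux_x_def)
  show "(1 / 4) *\<^sub>R UL - \<mu> *\<^sub>R lf_flux_x UL UR \<in> admissible"
    using lax_friedrichs_admissible[of UL "lf_speed_x UL UR" "-1" "flux_x UL" UR "flux_x UR" \<mu>]
      flux[of "-1"] assms by (simp add: lf_flux_x_def algebra_simps)
qed

lemma lf_flux_y_admissible:
  assumes "UL \<in> admissible" "UR \<in> admissible" "\<mu> > 0" "\<mu> * lf_speed_y UL UR < 1 / 4"
  shows "(1 / 4) *\<^sub>R UR + \<mu> *\<^sub>R lf_flux_y UL UR \<in> admissible"
    and "(1 / 4) *\<^sub>R UL - \<mu> *\<^sub>R lf_flux_y UL UR \<in> admissible"
proof -
  note flux = flux_y_admissible[OF assms(1) lf_speed_y_ge(1)[of UL UR]]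
    flux_y_admissible[OF assms(2) lf_speed_y_ge(2)[of UR UL]]
  show "(1 / 4) *\<^sub>R UR + \<mu> *\<^sub>R lf_flux_y UL UR \<in> admissible"
    using lax_friedrichs_admissible[of UR "lf_speed_y UL UR" 1 "flux_y UR" UL "flux_y UL" \<mu>]
      flux[of 1] assms by (simp add: lf_flux_y_def)
  show "(1 / 4) *\<^sub>R UL - \<mu> *\<^sub>R lf_flux_y UL UR \<in> admissible"
    using lax_friedrichs_admissible[of UL "lf_speed_y UL UR" "-1" "flux_y UL" UR "flux_y UR" \<mu>]
      flux[of "-1"] assms by (simp add: lf_flux_y_def algebra_simps)
qed

text \<open>The source shifts the velocity by \<open>(a, b)\<close>, at the cost of the kinetic energy of that shift.\<close>

lemma velocity_shift_admissible:
  assumes U: "U \<in> admissible" and ab: "a\<^sup>2 + b\<^sup>2 < 1 / ((gas_gamma - 1) * beta U)"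
  shows "U + vector [0, dens U * a, dens U * b, U $ 2 * a + U $ 3 * b] \<in> admissible"
proof -
  obtain r u v p where d: "U $ 1 = r" "r > 0" "U $ 2 = r * u" "U $ 3 = r * v"
    "U $ 4 = p / (gas_gamma - 1) + r * (u\<^sup>2 + v\<^sup>2) / 2" "p > 0"
    "dens U = r" "velx U = u" "vely U = v" "pressure U = p"
    using U by (rule admissibleE_split)
  \<comment> \<open>Since \<open>beta U\<close> is \<open>r / (2 * p)\<close>, the assumption puts
    the kinetic energy of the shift below the internal energy
    \<open>p / (gas_gamma - 1)\<close>.\<close>
  have "a\<^sup>2 + b\<^sup>2 < 2 * p / ((gas_gamma - 1) * r)"
    using ab d by (simp add: beta_def)
  then have pos: "p / (gas_gamma - 1) - r * (a\<^sup>2 + b\<^sup>2) / 2 > 0"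
    using d by (simp add: gas_gamma_def field_simps)
  show ?thesis
    by (rule admissibleI_split[where r = r and a = "u + a" and b = "v + b", OF _ _ _ _ _ pos])
      (use d(2) in \<open>simp_all add: d gas_gamma_def field_simps power2_eq_square\<close>)
qed

lemma square_less_of_source_bound:
  assumes "\<theta> \<noteq> 0 \<longrightarrow> r < 1 / (4 * \<bar>\<theta>\<bar>) * sqrt (1 / (2 * (gas_gamma - 1) * beta U))"
    and "r > 0" and "U \<in> admissible"
  shows "(4 * r * \<theta>)\<^sup>2 < 1 / (2 * (gas_gamma - 1) * beta U)"
proof (cases "\<theta> = 0")
  case True
  then show ?thesis using assms by (simp add: beta_def admissible_def gas_gamma_def)
next
  case False
  have nonneg: "0 \<le> 1 / (2 * (gas_gamma - 1) * beta U)"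
    using assms by (simp add: beta_def admissible_def gas_gamma_def)
  have "4 * r * \<bar>\<theta>\<bar> < sqrt (1 / (2 * (gas_gamma - 1) * beta U))"
    using assms(1) False by (simp add: field_simps)
  then have "(4 * r * \<bar>\<theta>\<bar>)\<^sup>2 < (sqrt (1 / (2 * (gas_gamma - 1) * beta U)))\<^sup>2"
    using assms by (intro power_strict_mono) auto
  then show ?thesis using nonneg by (simp add: power_mult_distrib)
qed


section \<open>Gauss--Lobatto quadrature\<close>

context
  fixes k :: nat and X w :: "nat \<Rightarrow> real"
  assumes gl: "gauss_lobatto k X w"
begin

lemma gl_k: "k \<ge> 1" and gl_left: "X 0 = -1" and gl_right: "X k = 1"
  using gl by (auto simp: gauss_lobatto_def)

lemma gl_exact: "degree q \<le> 2 * k - 1 \<Longrightarrow> (\<Sum>l\<le>k. w l * poly q (X l)) = integral {-1..1} (poly q)"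
  using gl by (auto simp: gauss_lobatto_def)

lemma gl_less: "l < m \<Longrightarrow> m \<le> k \<Longrightarrow> X l < X m"
  using gl by (auto simp: gauss_lobatto_def strict_mono_on_def)

lemma gl_eq_iff: "l \<le> k \<Longrightarrow> m \<le> k \<Longrightarrow> X l = X m \<longleftrightarrow> l = m"
  by (metis gl_less linorder_neqE_nat order_less_irrefl)

section \<open>Sum, positivity and symmetry of the weights\<close>

lemma gl_sum_weights: "(\<Sum>l\<le>k. w l) = 2"
proof -
  have "poly (1 :: real poly) = (\<lambda>_. 1)" by (rule ext) simp
  then show ?thesis using gl_exact[of 1] by simp
qed

text \<open>This isolates one weight; its positivity and symmetry follow by suitable choices of
  \<open>q\<close>.\<close>

lemma gl_single:
  assumes "degree q \<le> 2 * k - 1" "l \<le> k" "\<And>m. m \<le> k \<Longrightarrow> m \<noteq> l \<Longrightarrow> poly q (X m) = 0"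
  shows "w l * poly q (X l) = integral {-1..1} (poly q)"
proof -
  have "(\<Sum>m\<le>k. w m * poly q (X m)) = (\<Sum>m\<le>k. if m = l then w l * poly q (X l) else 0)"
    using assms by (intro sum.cong) auto
  then show ?thesis using gl_exact[OF assms(1)] assms(2) by simp
qed

text \<open>The rule is applied to a polynomial that is nonnegative on the interval, positive at
  \<open>X l\<close> and zero at the other nodes; its integral is positive.\<close>

lemma gl_weight_pos:
  assumes l: "l \<le> k"
  shows "w l > 0"
proof -
  \<comment> \<open>Interior factors are squared to fix their sign, but squaring the endpoint
    factors as well would exceed the degree of exactness. These stay simple, as \<open>1 - x\<close>
    and \<open>1 + x\<close> keep their sign on the interval; the one vanishing at
    \<open>X l\<close> is left out.\<close>
  define e :: "real poly" where
    "e = (if l = 0 then [:1, -1:] else if l = k then [:1, 1:] else [:1, 0, -1:])"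
  define I where "I = {1..<k} - {l}"
  define q where "q = e * (\<Prod>m\<in>I. [:- X m, 1:]\<^sup>2)"
  have poly_q: "poly q x = poly e x * (\<Prod>m\<in>I. (x - X m)\<^sup>2)" for x
    by (simp add: q_def poly_prod)
  have cardI: "2 * card I \<le> 2 * k - 1 - degree e" "degree e \<le> 2 * k - 1"
    using l gl_k by (auto simp: I_def e_def card_Diff_singleton_if)
  have "degree (\<Prod>m\<in>I. [:- X m, 1:]\<^sup>2) \<le> (\<Sum>m\<in>I. degree ([:- X m, 1:]\<^sup>2))"
    by (intro degree_prod_sum_le[unfolded o_def]) (simp add: I_def)
  also have "\<dots> \<le> (\<Sum>m\<in>I. 2)"
    by (intro sum_mono order_trans[OF degree_power_le]) simp
  finally have "degree (\<Prod>m\<in>I. [:- X m, 1:]\<^sup>2) \<le> 2 * card I" by simp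
  then have deg: "degree q \<le> 2 * k - 1"
    unfolding q_def using cardI degree_mult_le[of e "\<Prod>m\<in>I. [:- X m, 1:]\<^sup>2"] by linarith
  have e_nonneg: "poly e x \<ge> 0" if "x \<in> {-1..1}" for x
  proof -
    have "\<bar>x\<bar> \<le> 1" using that by auto
    then have "x * x \<le> 1" by (metis abs_square_le_1 power2_eq_square)
    then show ?thesis using that by (auto simp: e_def)
  qed
  have nonneg: "poly q x \<ge> 0" if "x \<in> {-1..1}" for x
    using e_nonneg[OF that] by (simp add: poly_q prod_nonneg)
  have zero: "poly q (X m) = 0" if "m \<le> k" "m \<noteq> l" for m
  proof (cases "m \<in> I")
    case True
    then show ?thesis by (auto simp: poly_q I_def intro!: prod_zero)
  next
    case False
    then have "m = 0 \<or> m = k" using that by (auto simp: I_def)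
    then show ?thesis using that by (auto simp: poly_q e_def gl_left gl_right)
  qed
  have X_in: "X l \<in> {-1..1}"
    using l gl_less[of 0 l] gl_less[of l k] gl_left gl_right
    by (cases "l = 0"; cases "l = k") auto
  have e_pos: "poly e (X l) > 0"
  proof -
    have "X l * X l < 1" if "l \<noteq> 0" "l \<noteq> k"
    proof -
      have "\<bar>X l\<bar> < 1" using that l gl_less[of 0 l] gl_less[of l k] gl_left gl_right by auto
      then show ?thesis by (metis abs_square_less_1 power2_eq_square)
    qed
    then show ?thesis using gl_left gl_right by (auto simp: e_def)
  qed
  have pos: "poly q (X l) > 0"
    unfolding poly_q
    using e_pos l by (intro mult_pos_pos prod_pos) (auto simp: I_def gl_eq_iff)
  have cont: "continuous_on {-1..1} (poly q)"
    by (intro continuous_intros)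
  then have "integral {-1..1} (poly q) \<noteq> 0"
    using integral_eq_0_iff[of "-1" 1 "poly q"] nonneg pos X_in by fastforce
  moreover have "integral {-1..1} (poly q) \<ge> 0"
    using nonneg by (intro integral_nonneg integrable_continuous_real cont) auto
  ultimately have "w l * poly q (X l) > 0"
    using gl_single[OF deg l zero] by simp
  then show ?thesis using pos by (simp add: zero_less_mult_iff)
qed

text \<open>
  With \<open>q\<close> the polynomial of the interior nodes, the rule is applied to \<open>(1 \<mp> x) q(x) q(-x)\<close>:
  these vanish at all nodes but one and are reflections of each other.
\<close>

lemma gl_weights_symmetric: "w k = w 0"
proof -
  define q :: "real poly" where "q = (\<Prod>m\<in>{1..<k}. [:- X m, 1:])"
  define h where "h = q * pcompose q [:0, -1:]"
  have poly_q: "poly q x = (\<Prod>m\<in>{1..<k}. x - X m)" for x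
    by (simp add: q_def poly_prod)
  have poly_h: "poly h x = poly q x * poly q (- x)" for x
    by (simp add: h_def poly_pcompose)
  have "degree q \<le> (\<Sum>m\<in>{1..<k}. degree [:- X m, 1:])"
    unfolding q_def by (intro degree_prod_sum_le[unfolded o_def]) simp
  then have degq: "degree q \<le> k - 1" by simp
  have degp: "degree (pcompose q [:0, -1:]) \<le> k - 1"
    using degq by (simp add: degree_pcompose)
  have deg: "degree ([:1, c:] * h) \<le> 2 * k - 1" for c
  proof -
    have "degree ([:1, c:] * h) \<le> 1 + degree h"
      by (rule order_trans[OF degree_mult_le]) simp
    moreover have "degree h \<le> (k - 1) + (k - 1)"
      unfolding h_def by (rule order_trans[OF degree_mult_le add_mono[OF degq degp]])
    ultimately show ?thesis using gl_k by linarith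
  qed
  have zero: "poly h (X m) = 0" if "m \<le> k" "m \<noteq> 0" "m \<noteq> k" for m
    using that by (auto simp: poly_h poly_q intro!: prod_zero)
  have zero_right: "poly h (X m) + X m * poly h (X m) = 0" if "m \<le> k" "m \<noteq> k" for m
    using that by (cases "m = 0") (auto simp: zero gl_left)
  have left: "w 0 * poly ([:1, -1:] * h) (X 0) = integral {-1..1} (poly ([:1, -1:] * h))"
    by (rule gl_single[OF deg]) (auto intro!: zero simp: gl_right)
  have right: "w k * poly ([:1, 1:] * h) (X k) = integral {-1..1} (poly ([:1, 1:] * h))"
    by (rule gl_single[OF deg]) (auto simp: zero_right)
  \<comment> \<open>\<open>h\<close> is even by construction, so reflection exchanges the factors
    \<open>1 - x\<close> and \<open>1 + x\<close>.\<close>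
  have "integral {-1..1} (poly ([:1, -1:] * h)) = integral {-1..1} (\<lambda>x. poly ([:1, 1:] * h) (- x))"
    by (intro integral_cong) (simp add: poly_h)
  also have "\<dots> = integral {-1..1} (poly ([:1, 1:] * h))"
    using Henstock_Kurzweil_Integration.integral_reflect_real[of 1 "-1" "poly ([:1, 1:] * h)"]
    by (simp only: minus_minus)
  \<comment> \<open>Both endpoint factors take the value 2 at their own node and cancel.\<close>
  finally have "w 0 * poly h (-1) = w k * poly h 1"
    using left right by (simp add: gl_left gl_right)
  moreover have "poly h (-1) = poly h 1" by (simp add: poly_h)
  moreover have "poly h 1 \<noteq> 0"
  proof -
    have "1 - X m \<noteq> 0 \<and> - 1 - X m \<noteq> 0" if "m \<in> {1..<k}" for m
      using that gl_less[of 0 m] gl_less[of m k] by (auto simp: gl_left gl_right)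
    then show ?thesis by (simp add: poly_h poly_q)
  qed
  ultimately show ?thesis by simp
qed

section \<open>Lagrange basis and summation by parts\<close>

lemma lagrange_at_node:
  assumes "l \<le> k" "m \<le> k"
  shows "poly (lagrange_basis k X l) (X m) = (if m = l then 1 else 0)"
proof (cases "m = l")
  case True
  have "poly (smult (1 / (X l - X n)) [:- X n, 1:]) (X l) = 1" if "n \<in> {..k} - {l}" for n
    using that assms gl_eq_iff[of l n] by (simp flip: diff_divide_distrib)
  then show ?thesis
    using True by (simp add: lagrange_basis_def poly_prod del: poly_smult poly_pCons)
next
  case False
  then show ?thesis
    using assms by (auto simp: lagrange_basis_def poly_prod intro!: prod_zero)
qed

lemma degree_lagrange: "l \<le> k \<Longrightarrow> degree (lagrange_basis k X l) \<le> k"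
proof -
  assume l: "l \<le> k"
  have "degree (lagrange_basis k X l) \<le>
      (\<Sum>m\<in>{..k} - {l}. degree (smult (1 / (X l - X m)) [:- X m, 1:]))"
    unfolding lagrange_basis_def by (intro degree_prod_sum_le[unfolded o_def]) simp
  also have "\<dots> \<le> (\<Sum>m\<in>{..k} - {l}. 1)"
    by (intro sum_mono order_trans[OF degree_smult_le]) simp
  finally show ?thesis using l by simp
qed

text \<open>The derivative of a product of two basis polynomials is integrated exactly: the
  quadrature sum gives the two matrix entries, the fundamental theorem of calculus the boundary
  values.\<close>

lemma summation_by_parts:
  assumes i: "i \<le> k" and l: "l \<le> k"
  shows "w i * diff_matrix k X i l + w l * diff_matrix k X l i = (if i = l then bdry_sign k i else 0)"
proof -
  let ?L = "lagrange_basis k X"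
  define q where "q = ?L i * ?L l"
  have "degree q \<le> k + k"
    unfolding q_def
    by (rule order_trans[OF degree_mult_le add_mono[OF degree_lagrange[OF i] degree_lagrange[OF l]]])
  then have "degree (pderiv q) \<le> 2 * k - 1" by (simp add: degree_pderiv)
  note exact = gl_exact[OF this]
  \<comment> \<open>By the product rule and the Lagrange property only \<open>m = i\<close> and
    \<open>m = l\<close> contribute; if they coincide, both terms sit at the same node.\<close>
  have "(\<Sum>m\<le>k. w m * poly (pderiv q) (X m)) =
      (\<Sum>m\<le>k. if m = i then w i * diff_matrix k X i l else 0)
      + (\<Sum>m\<le>k. if m = l then w l * diff_matrix k X l i else 0)"
    unfolding sum.distrib[symmetric] using i l
    by (intro sum.cong) (auto simp: q_def pderiv_mult lagrange_at_node diff_matrix_def algebra_simps)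
  then have "w i * diff_matrix k X i l + w l * diff_matrix k X l i = integral {-1..1} (poly (pderiv q))"
    using exact i l by simp
  also have "\<dots> = poly q 1 - poly q (-1)"
    by (intro integral_unique fundamental_theorem_of_calculus)
      (auto simp flip: has_real_derivative_iff_has_vector_derivative
        intro: DERIV_subset[OF poly_DERIV])
  also have "\<dots> = poly q (X k) - poly q (X 0)" by (simp add: gl_left gl_right)
  also have "\<dots> = (if i = l then bdry_sign k i else 0)"
    using i l gl_k by (auto simp: q_def lagrange_at_node bdry_sign_def)
  finally show ?thesis .
qed

text \<open>The factor 2 gives two copies of the double sum. Exchanging the indices in one pairs
  each weighted entry with its transpose, and summation by parts leaves only the diagonal at the
  endpoints.\<close>

lemma symmetric_flux_sum:
  fixes f :: "nat \<Rightarrow> nat \<Rightarrow> 'a::real_vector"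
  assumes sym: "\<And>i l. i \<le> k \<Longrightarrow> l \<le> k \<Longrightarrow> f i l = f l i"
  shows "(\<Sum>i\<le>k. w i *\<^sub>R (\<Sum>l\<le>k. (2 * diff_matrix k X i l) *\<^sub>R f i l)) =
    (\<Sum>i\<le>k. bdry_sign k i *\<^sub>R f i i)"
proof -
  let ?D = "diff_matrix k X"
  have "(\<Sum>i\<le>k. w i *\<^sub>R (\<Sum>l\<le>k. (2 * ?D i l) *\<^sub>R f i l)) =
      (\<Sum>i\<le>k. \<Sum>l\<le>k. (w i * ?D i l) *\<^sub>R f i l) + (\<Sum>i\<le>k. \<Sum>l\<le>k. (w i * ?D i l) *\<^sub>R f i l)"
    by (simp add: scaleR_sum_right mult.left_commute[of _ 2] flip: sum.distrib scaleR_add_left)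
  also have "(\<Sum>i\<le>k. \<Sum>l\<le>k. (w i * ?D i l) *\<^sub>R f i l) + (\<Sum>i\<le>k. \<Sum>l\<le>k. (w i * ?D i l) *\<^sub>R f i l) =
      (\<Sum>i\<le>k. \<Sum>l\<le>k. (w i * ?D i l) *\<^sub>R f i l) + (\<Sum>i\<le>k. \<Sum>l\<le>k. (w l * ?D l i) *\<^sub>R f l i)"
    by (subst (2) sum.swap) (rule refl)
  also have "\<dots> = (\<Sum>i\<le>k. \<Sum>l\<le>k. (w i * ?D i l + w l * ?D l i) *\<^sub>R f i l)"
    by (simp add: sum.distrib scaleR_add_left sym)
  also have "\<dots> = (\<Sum>i\<le>k. \<Sum>l\<le>k. if l = i then bdry_sign k i *\<^sub>R f i i else 0)"
    by (intro sum.cong refl) (auto simp: summation_by_parts)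
  also have "\<dots> = (\<Sum>i\<le>k. bdry_sign k i *\<^sub>R f i i)"
    by simp
  finally show ?thesis .
qed

text \<open>With \<open>f\<close> the two-point flux between nodes of a line, \<open>f i i\<close>
  is the physical flux by consistency, so the volume terms cancel the inner boundary fluxes of the
  scheme.\<close>

lemma flux_difference_sum:
  fixes f :: "nat \<Rightarrow> nat \<Rightarrow> 'a::real_vector"
  assumes "\<And>i l. i \<le> k \<Longrightarrow> l \<le> k \<Longrightarrow> f i l = f l i"
  shows "(\<Sum>i\<le>k. w i *\<^sub>R
    ((bdry_sign k i / w i) *\<^sub>R f i i - (\<Sum>l\<le>k. (2 * diff_matrix k X i l) *\<^sub>R f i l))) = 0"
proof -
  have "(\<Sum>i\<le>k. w i *\<^sub>R (bdry_sign k i / w i) *\<^sub>R f i i) = (\<Sum>i\<le>k. bdry_sign k i *\<^sub>R f i i)"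
    by (intro sum.cong refl) (use gl_weight_pos in \<open>force simp: less_le\<close>)
  then show ?thesis
    by (simp add: scaleR_diff_right sum_subtractf symmetric_flux_sum[OF assms])
qed

section \<open>Cell averages and the limiter\<close>

lemma gl_sum_product_weights: "(\<Sum>i1\<le>k. \<Sum>j1\<le>k. w i1 * w j1 / 4) = 1"
proof -
  have "(\<Sum>i1\<le>k. \<Sum>j1\<le>k. w i1 * w j1 / 4) = (\<Sum>i1\<le>k. w i1) * (\<Sum>j1\<le>k. w j1) / 4"
    by (simp add: sum_product sum_divide_distrib)
  then show ?thesis by (simp add: gl_sum_weights)
qed

lemma cell_average_nth:
  "cell_average k w V $ c = (\<Sum>i1\<le>k. \<Sum>j1\<le>k. w i1 * w j1 / 4 * V i1 j1 $ c)"
  by (simp add: cell_average_def)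

text \<open>The limiter forms affine combinations with coefficients constant on the cell; weights of
  total 1 let averaging commute with them.\<close>

lemma weighted_average_affine:
  "(\<Sum>i1\<le>k. \<Sum>j1\<le>k. w i1 * w j1 / 4 * (a + b * f i1 j1)) =
    a + b * (\<Sum>i1\<le>k. \<Sum>j1\<le>k. w i1 * w j1 / 4 * f i1 j1)"
proof -
  have "(\<Sum>i1\<le>k. \<Sum>j1\<le>k. w i1 * w j1 / 4 * (a + b * f i1 j1)) =
      a * (\<Sum>i1\<le>k. \<Sum>j1\<le>k. w i1 * w j1 / 4) + b * (\<Sum>i1\<le>k. \<Sum>j1\<le>k. w i1 * w j1 / 4 * f i1 j1)"
    by (simp add: sum_distrib_left sum.distrib algebra_simps add_divide_distrib)
  then show ?thesis by (simp only: gl_sum_product_weights mult_1_right)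
qed

lemma cell_average_scaled_state:
  "cell_average k w (scaled_state k w V) = cell_average k w V"
proof -
  have "cell_average k w (scaled_state k w V) $ 1 = cell_average k w V $ 1"
    unfolding cell_average_nth scaled_state_def vector_4 weighted_average_affine dens_def
    by (simp add: algebra_simps)
  then show ?thesis
    by (simp add: vec_eq_iff forall_4 cell_average_nth scaled_state_def)
qed

lemma cell_average_pp_limiter:
  "cell_average k w (pp_limiter k w V) = cell_average k w V"
proof -
  define S where "S = scaled_state k w V"
  have S: "cell_average k w S = cell_average k w V"
    by (simp add: S_def cell_average_scaled_state)
  have "cell_average k w (pp_limiter k w V) $ c = cell_average k w V $ c" for c
  proof -
    have "cell_average k w (pp_limiter k w V) $ c =
        (1 - lim_theta2 k w V) * cell_average k w V $ c + lim_theta2 k w V * cell_average k w S $ c"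
      unfolding cell_average_nth[of S] weighted_average_affine[symmetric]
      unfolding cell_average_nth[of "pp_limiter k w V"] by (simp add: pp_limiter_def S_def)
    then show ?thesis by (simp add: S algebra_simps)
  qed
  then show ?thesis by (simp add: vec_eq_iff)
qed

lemma cell_average_add:
  "cell_average k w (\<lambda>i1 j1. A i1 j1 + B i1 j1) = cell_average k w A + cell_average k w B"
  by (simp add: cell_average_def scaleR_add_right sum.distrib)

lemma cell_average_scaleR:
  "cell_average k w (\<lambda>i1 j1. c *\<^sub>R A i1 j1) = c *\<^sub>R cell_average k w A"
  by (simp add: cell_average_def scaleR_sum_right mult.commute)

text \<open>The tensor product rule may be summed first along lines of constant \<open>j1\<close>,
  where the one-dimensional cancellation \<open>flux_difference_sum\<close> applies.\<close>

lemma cell_average_zero_x: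
  assumes "\<And>j1. j1 \<le> k \<Longrightarrow> (\<Sum>i1\<le>k. w i1 *\<^sub>R A i1 j1) = 0"
  shows "cell_average k w A = 0"
proof -
  have "cell_average k w A = (\<Sum>j1\<le>k. (w j1 / 4) *\<^sub>R (\<Sum>i1\<le>k. w i1 *\<^sub>R A i1 j1))"
    unfolding cell_average_def by (subst sum.swap) (simp add: scaleR_sum_right mult.commute)
  then show ?thesis using assms by simp
qed

lemma cell_average_zero_y:
  assumes "\<And>i1. i1 \<le> k \<Longrightarrow> (\<Sum>j1\<le>k. w j1 *\<^sub>R A i1 j1) = 0"
  shows "cell_average k w A = 0"
proof -
  have "cell_average k w A = (\<Sum>i1\<le>k. (w i1 / 4) *\<^sub>R (\<Sum>j1\<le>k. w j1 *\<^sub>R A i1 j1))"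
    by (simp add: cell_average_def scaleR_sum_right)
  then show ?thesis using assms by simp
qed

text \<open>
  The entropy conservative fluxes cancel in the cell average; only the numerical fluxes at the
  faces remain, and they are attributed to the boundary nodes.
\<close>

lemma cell_average_forward_euler:
  assumes FS: "entropy_conservative_x FS" and GS: "entropy_conservative_y GS"
    and U: "\<And>i1 j1. i1 \<le> k \<Longrightarrow> j1 \<le> k \<Longrightarrow> U i j i1 j1 \<in> admissible"
  shows "cell_average k w (forward_euler k X w dx dy dt FS GS Ue U i j) =
    cell_average k w (\<lambda>i1 j1. U i j i1 j1
      + dt *\<^sub>R source_term dx dy (Theta k X FS Ue i j i1 j1) (Xi k X GS Ue i j i1 j1) (U i j i1 j1)
      - (2 * (dt / dx) * (bdry_sign k i1 / w i1)) *\<^sub>R num_flux_x k U i j i1 j1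
      - (2 * (dt / dy) * (bdry_sign k j1 / w j1)) *\<^sub>R num_flux_y k U i j i1 j1)"
    (is "_ = cell_average k w ?V")
proof -
  \<comment> \<open>\<open>P\<close> and \<open>Q\<close> gather the volume term and the inner flux
    of one direction each, the inner flux being written as a diagonal value of the two-point
    flux.\<close>
  define P where "P i1 j1 = (bdry_sign k i1 / w i1) *\<^sub>R FS (U i j i1 j1) (U i j i1 j1)
      - (\<Sum>l\<le>k. (2 * diff_matrix k X i1 l) *\<^sub>R FS (U i j i1 j1) (U i j l j1))" for i1 j1
  define Q where "Q i1 j1 = (bdry_sign k j1 / w j1) *\<^sub>R GS (U i j i1 j1) (U i j i1 j1)
      - (\<Sum>l\<le>k. (2 * diff_matrix k X j1 l) *\<^sub>R GS (U i j i1 j1) (U i j i1 l))" for i1 j1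
  have "cell_average k w P = 0"
    using FS U unfolding P_def
    by (intro cell_average_zero_x flux_difference_sum[where f = "\<lambda>i1 l. FS (U i j i1 _) (U i j l _)"])
      (auto simp: entropy_conservative_x_def)
  moreover have "cell_average k w Q = 0"
    using GS U unfolding Q_def
    by (intro cell_average_zero_y flux_difference_sum[where f = "\<lambda>j1 l. GS (U i j _ j1) (U i j _ l)"])
      (auto simp: entropy_conservative_y_def)
  moreover have "cell_average k w (forward_euler k X w dx dy dt FS GS Ue U i j) =
      cell_average k w (\<lambda>i1 j1. ?V i1 j1
        + ((2 * (dt / dx)) *\<^sub>R P i1 j1 + (2 * (dt / dy)) *\<^sub>R Q i1 j1))"
    unfolding cell_average_def
  proof (intro sum.cong refl arg_cong[where f = "\<lambda>x. _ *\<^sub>R x"])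
    fix i1 j1
    assume "i1 \<in> {..k}" "j1 \<in> {..k}"
    then have "FS (U i j i1 j1) (U i j i1 j1) = flux_x (U i j i1 j1)"
      "GS (U i j i1 j1) (U i j i1 j1) = flux_y (U i j i1 j1)"
      using FS GS U by (auto simp: entropy_conservative_x_def entropy_conservative_y_def)
    then show "forward_euler k X w dx dy dt FS GS Ue U i j i1 j1 =
        ?V i1 j1 + ((2 * (dt / dx)) *\<^sub>R P i1 j1 + (2 * (dt / dy)) *\<^sub>R Q i1 j1)"
      by (simp add: forward_euler_def dg_operator_def P_def Q_def algebra_simps)
  qed
  ultimately show ?thesis
    by (simp add: cell_average_add cell_average_scaleR)
qed

section \<open>Numerical fluxes at the faces\<close>

lemma num_flux_x_admissible:
  assumes "lx > 0" and "U i j i1 j1 \<in> admissible"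
    and "U (i - 1) j k j1 \<in> admissible" "U (i + 1) j 0 j1 \<in> admissible"
    and "lx * lf_speed_x (U (i - 1) j k j1) (U i j 0 j1) < w 0 / 8"
    and "lx * lf_speed_x (U i j k j1) (U (i + 1) j 0 j1) < w 0 / 8"
  shows "(1 / 4) *\<^sub>R U i j i1 j1
    - (2 * lx * (bdry_sign k i1 / w i1)) *\<^sub>R num_flux_x k U i j i1 j1 \<in> admissible"
proof -
  have w0: "w 0 > 0" using gl_weight_pos by simp
  \<comment> \<open>The boundary term is divided by the node weight, hence this
    \<open>\<mu>\<close>; the bound \<open>w 0 / 8\<close> times \<open>2 / w 0\<close> is exactly
    \<open>1 / 4\<close>.\<close>
  have \<mu>: "2 * lx / w 0 > 0" using w0 assms by simp
  have \<mu>\<alpha>: "2 * lx / w 0 * \<alpha> < 1 / 4" if "lx * \<alpha> < w 0 / 8" for \<alpha>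
    using that w0 by (simp add: field_simps)
  consider "i1 = 0" | "i1 = k" "i1 \<noteq> 0" | "i1 \<noteq> 0" "i1 \<noteq> k" by blast
  then show ?thesis
  proof cases
    case 1
    then show ?thesis
      using lf_flux_x_admissible(1)[OF _ _ \<mu> \<mu>\<alpha>[OF assms(5)]] assms
      by (simp add: num_flux_x_def bdry_sign_def)
  next
    case 2
    \<comment> \<open>The right endpoint brings in \<open>w k\<close>, while the bound involves
      \<open>w 0\<close>; symmetry of the weights reconciles them.\<close>
    then show ?thesis
      using lf_flux_x_admissible(2)[OF _ _ \<mu> \<mu>\<alpha>[OF assms(6)]] assms gl_weights_symmetric
      by (simp add: num_flux_x_def bdry_sign_def)
  next
    case 3
    then show ?thesis
      using assms by (simp add: num_flux_x_def admissible_scaleR)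
  qed
qed

lemma num_flux_y_admissible:
  assumes "ly > 0" and "U i j i1 j1 \<in> admissible"
    and "U i (j - 1) i1 k \<in> admissible" "U i (j + 1) i1 0 \<in> admissible"
    and "ly * lf_speed_y (U i (j - 1) i1 k) (U i j i1 0) < w 0 / 8"
    and "ly * lf_speed_y (U i j i1 k) (U i (j + 1) i1 0) < w 0 / 8"
  shows "(1 / 4) *\<^sub>R U i j i1 j1
    - (2 * ly * (bdry_sign k j1 / w j1)) *\<^sub>R num_flux_y k U i j i1 j1 \<in> admissible"
proof -
  have w0: "w 0 > 0" using gl_weight_pos by simp
  have \<mu>: "2 * ly / w 0 > 0" using w0 assms by simp
  have \<mu>\<alpha>: "2 * ly / w 0 * \<alpha> < 1 / 4" if "ly * \<alpha> < w 0 / 8" for \<alpha>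
    using that w0 by (simp add: field_simps)
  consider "j1 = 0" | "j1 = k" "j1 \<noteq> 0" | "j1 \<noteq> 0" "j1 \<noteq> k" by blast
  then show ?thesis
  proof cases
    case 1
    then show ?thesis
      using lf_flux_y_admissible(1)[OF _ _ \<mu> \<mu>\<alpha>[OF assms(5)]] assms
      by (simp add: num_flux_y_def bdry_sign_def)
  next
    case 2
    then show ?thesis
      using lf_flux_y_admissible(2)[OF _ _ \<mu> \<mu>\<alpha>[OF assms(6)]] assms gl_weights_symmetric
      by (simp add: num_flux_y_def bdry_sign_def)
  next
    case 3
    then show ?thesis
      using assms by (simp add: num_flux_y_def admissible_scaleR)
  qed
qed

end


section \<open>The time step restriction\<close>

lemma source_admissible:
  assumes U: "U \<in> admissible" and "dx > 0" "dy > 0" "dt > 0"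
    and "\<theta> \<noteq> 0 \<longrightarrow> dt / dx < 1 / (4 * \<bar>\<theta>\<bar>) * sqrt (1 / (2 * (gas_gamma - 1) * beta U))"
    and "\<xi> \<noteq> 0 \<longrightarrow> dt / dy < 1 / (4 * \<bar>\<xi>\<bar>) * sqrt (1 / (2 * (gas_gamma - 1) * beta U))"
  shows "(1 / 2) *\<^sub>R U + dt *\<^sub>R source_term dx dy \<theta> \<xi> U \<in> admissible"
proof -
  \<comment> \<open>The 4 is the 2 of \<open>source_term\<close> times the 2 from factoring out the
    share \<open>1 / 2\<close> of \<open>U\<close>.\<close>
  define a where "a = 4 * (dt / dx) * \<theta>"
  define b where "b = 4 * (dt / dy) * \<xi>"
  \<comment> \<open>The two directions split the kinetic energy budget equally, whence the 2 under
    the root of the restriction.\<close>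
  have half: "1 / (2 * (gas_gamma - 1) * beta U) + 1 / (2 * (gas_gamma - 1) * beta U)
      = 1 / ((gas_gamma - 1) * beta U)"
    by (simp add: gas_gamma_def)
  have "a\<^sup>2 < 1 / (2 * (gas_gamma - 1) * beta U)" "b\<^sup>2 < 1 / (2 * (gas_gamma - 1) * beta U)"
    unfolding a_def b_def using assms by (intro square_less_of_source_bound; simp)+
  then have "a\<^sup>2 + b\<^sup>2 < 1 / ((gas_gamma - 1) * beta U)"
    unfolding half[symmetric] by (rule add_strict_mono)
  then have "(1 / 2) *\<^sub>R (U + vector [0, dens U * a, dens U * b, U $ 2 * a + U $ 3 * b]) \<in> admissible"
    by (intro admissible_scaleR velocity_shift_admissible U) auto
  also have "(1 / 2) *\<^sub>R (U + vector [0, dens U * a, dens U * b, U $ 2 * a + U $ 3 * b]) =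
      (1 / 2) *\<^sub>R U + dt *\<^sub>R source_term dx dy \<theta> \<xi> U"
    by (simp add: vec_eq_iff forall_4 source_term_def a_def b_def field_simps)
  finally show ?thesis .
qed

lemma lf_speed_pos:
  assumes "UL \<in> admissible"
  shows "lf_speed_x UL UR > 0" "lf_speed_y UL UR > 0"
  using lf_speed_x_ge(1)[of UL UR] lf_speed_y_ge(1)[of UL UR] sound_pos[OF assms] by linarith+

text \<open>A positive speed of at most \<open>M\<close> makes \<open>M\<close> positive, so the
  division can be cleared.\<close>

lemma cfl_mult_less:
  fixes \<alpha> M r c :: real
  assumes "0 < \<alpha>" "\<alpha> \<le> M" "r < c / (8 * M)" "r > 0"
  shows "r * \<alpha> < c / 8"
proof -
  have "r * \<alpha> \<le> r * M"
    using assms by (intro mult_left_mono) auto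
  moreover have "r * M < c / 8"
    using assms by (simp add: field_simps)
  ultimately show ?thesis by linarith
qed

lemma finite_nodal_values:
  fixes f :: "nat \<Rightarrow> nat \<Rightarrow> nat \<Rightarrow> nat \<Rightarrow> 'a"
  shows "finite {f i j i1 j1 | i j i1 j1. i \<in> {1..M} \<and> j \<in> {1..N} \<and> i1 \<le> k \<and> j1 \<le> k}"
  by (rule finite_surj[of "{1..M} \<times> {1..N} \<times> {..k} \<times> {..k}" _ "\<lambda>(i, j, i1, j1). f i j i1 j1"])
    force+

lemma finite_face_values:
  fixes f :: "nat \<Rightarrow> nat \<Rightarrow> nat \<Rightarrow> 'a"
  shows "finite {f i j l | i j l. i \<in> {a..M} \<and> j \<in> {b..N} \<and> l \<le> k}"
  by (rule finite_surj[of "{a..M} \<times> {b..N} \<times> {..k}" _ "\<lambda>(i, j, l). f i j l"]) force+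

lemma lf_speed_x_le_max:
  assumes "i \<le> Nx" "j \<in> {1..Ny}" "j1 \<le> k"
  shows "lf_speed_x (U i j k j1) (U (i + 1) j 0 j1) \<le> max_speed_x k Nx Ny U"
  unfolding max_speed_x_def
  by (intro Max_ge finite_UnI finite_nodal_values finite_face_values UnI2 CollectI
      exI[of _ i] exI[of _ j] exI[of _ j1]) (use assms in simp)

lemma lf_speed_y_le_max:
  assumes "i \<in> {1..Nx}" "j \<le> Ny" "i1 \<le> k"
  shows "lf_speed_y (U i j i1 k) (U i (j + 1) i1 0) \<le> max_speed_y k Nx Ny U"
  unfolding max_speed_y_def
  by (intro Max_ge finite_UnI finite_nodal_values finite_face_values UnI2 CollectI
      exI[of _ i] exI[of _ j] exI[of _ i1]) (use assms in simp)

section \<open>Positivity of the new cell averages\<close>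

theorem theorem4p3:
  fixes k Nx Ny :: nat
    and xa ya dx dy dt :: real
    and X w :: "nat \<Rightarrow> real"
    and FS GS :: "state \<Rightarrow> state \<Rightarrow> state"
    and \<phi> :: "real \<times> real \<Rightarrow> real"
    and Ue :: "real \<times> real \<Rightarrow> state"
    and U :: nodal_field
  defines "Ueh \<equiv> nodal_values xa ya dx dy X Ue"
  assumes "gauss_lobatto k X w"
    and "Nx \<ge> 1" and "Ny \<ge> 1" and "dx > 0" and "dy > 0" and "dt > 0"
    and "entropy_conservative_x FS" and "entropy_conservative_y GS"
    and "hydrostatic_on (rect_domain xa ya dx dy Nx Ny) \<phi> Ue"
    and "\<forall>i\<in>{1..Nx}. \<forall>j\<in>{1..Ny}. \<forall>i1\<le>k. \<forall>j1\<le>k. U i j i1 j1 \<in> admissible"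
    and "exterior_admissible k Nx Ny U"
    and "dt / dx < w 0 / (8 * max_speed_x k Nx Ny U)"
    and "source_cfl k Nx Ny (dt / dx) (Theta k X FS Ueh) U"
    and "dt / dy < w 0 / (8 * max_speed_y k Nx Ny U)"
    and "source_cfl k Nx Ny (dt / dy) (Xi k X GS Ueh) U"
  shows "\<forall>i\<in>{1..Nx}. \<forall>j\<in>{1..Ny}.
     cell_average k w (dg_step k X w dx dy dt FS GS Ueh U i j) \<in> admissible"
proof (intro ballI)
  fix i j
  assume i: "i \<in> {1..Nx}" and j: "j \<in> {1..Ny}"
  have cell: "U i' j' i1 j1 \<in> admissible"
    if "i' \<in> {1..Nx}" "j' \<in> {1..Ny}" "i1 \<le> k" "j1 \<le> k" for i' j' i1 j1
    using assms(11) that by blast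
  have lx: "dt / dx > 0" and ly: "dt / dy > 0"
    using assms(5-7) by simp_all
  \<comment> \<open>The outer trace on each side belongs to a neighbouring cell or, at the boundary
    of the domain, is an exterior state.\<close>
  have left: "U (i - 1) j k j1 \<in> admissible" if "j1 \<le> k" for j1
  proof (cases "i = 1")
    case True
    then show ?thesis using assms(12) i j that by (simp add: exterior_admissible_def)
  next
    case False
    then have "i - 1 \<in> {1..Nx}" using i by auto
    then show ?thesis using cell j that by blast
  qed
  have right: "U (i + 1) j 0 j1 \<in> admissible" if "j1 \<le> k" for j1
  proof (cases "i = Nx")
    case True
    then show ?thesis using assms(12) i j that by (simp add: exterior_admissible_def)
  next
    case False
    then have "i + 1 \<in> {1..Nx}" using i by auto
    then show ?thesis using cell j that by blast
  qed
  have bottom: "U i (j - 1) i1 k \<in> admissible" if "i1 \<le> k" for i1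
  proof (cases "j = 1")
    case True
    then show ?thesis using assms(12) i j that by (simp add: exterior_admissible_def)
  next
    case False
    then have "j - 1 \<in> {1..Ny}" using j by auto
    then show ?thesis using cell i that by blast
  qed
  have top: "U i (j + 1) i1 0 \<in> admissible" if "i1 \<le> k" for i1
  proof (cases "j = Ny")
    case True
    then show ?thesis using assms(12) i j that by (simp add: exterior_admissible_def)
  next
    case False
    then have "j + 1 \<in> {1..Ny}" using j by auto
    then show ?thesis using cell i that by blast
  qed
  \<comment> \<open>\<open>V\<close> shares the cell average of the forward Euler update, but lacks
    the volume fluxes; it is \<open>V\<close> that is shown admissible node by node.\<close>
  define V where "V i1 j1 = U i j i1 j1
      + dt *\<^sub>R source_term dx dy (Theta k X FS Ueh i j i1 j1) (Xi k X GS Ueh i j i1 j1) (U i j i1 j1)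
      - (2 * (dt / dx) * (bdry_sign k i1 / w i1)) *\<^sub>R num_flux_x k U i j i1 j1
      - (2 * (dt / dy) * (bdry_sign k j1 / w j1)) *\<^sub>R num_flux_y k U i j i1 j1" for i1 j1
  have "V i1 j1 \<in> admissible" if q: "i1 \<le> k" "j1 \<le> k" for i1 j1
  proof -
    let ?U = "U i j i1 j1"
    have src: "(1 / 2) *\<^sub>R ?U + dt *\<^sub>R source_term dx dy
        (Theta k X FS Ueh i j i1 j1) (Xi k X GS Ueh i j i1 j1) ?U \<in> admissible"
      using assms(14,16) i j q
      by (intro source_admissible cell assms(5-7)) (auto simp: source_cfl_def)
    have fx: "(1 / 4) *\<^sub>R ?U
        - (2 * (dt / dx) * (bdry_sign k i1 / w i1)) *\<^sub>R num_flux_x k U i j i1 j1 \<in> admissible"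
    proof (intro num_flux_x_admissible[OF assms(2)] lx cell[OF i j q] left[OF q(2)] right[OF q(2)])
      \<comment> \<open>The left face of cell \<open>i\<close> is listed under \<open>i - 1\<close>,
        which may be 0; \<open>i \<ge> 1\<close> makes \<open>i - 1 + 1\<close> return to
        \<open>i\<close>.\<close>
      have "lf_speed_x (U (i - 1) j k j1) (U i j 0 j1) \<le> max_speed_x k Nx Ny U"
        using lf_speed_x_le_max[of "i - 1" Nx j Ny j1 k U] i j q by force
      then show "dt / dx * lf_speed_x (U (i - 1) j k j1) (U i j 0 j1) < w 0 / 8"
        by (intro cfl_mult_less[OF lf_speed_pos(1)[OF left] _ assms(13) lx] q)
      show "dt / dx * lf_speed_x (U i j k j1) (U (i + 1) j 0 j1) < w 0 / 8"
        using i j q by (intro cfl_mult_less[OF lf_speed_pos(1)[OF cell] lf_speed_x_le_max assms(13) lx]) auto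
    qed
    have fy: "(1 / 4) *\<^sub>R ?U
        - (2 * (dt / dy) * (bdry_sign k j1 / w j1)) *\<^sub>R num_flux_y k U i j i1 j1 \<in> admissible"
    proof (intro num_flux_y_admissible[OF assms(2)] ly cell[OF i j q] bottom[OF q(1)] top[OF q(1)])
      have "lf_speed_y (U i (j - 1) i1 k) (U i j i1 0) \<le> max_speed_y k Nx Ny U"
        using lf_speed_y_le_max[of i Nx "j - 1" Ny i1 k U] i j q by force
      then show "dt / dy * lf_speed_y (U i (j - 1) i1 k) (U i j i1 0) < w 0 / 8"
        by (intro cfl_mult_less[OF lf_speed_pos(2)[OF bottom] _ assms(15) ly] q)
      show "dt / dy * lf_speed_y (U i j i1 k) (U i (j + 1) i1 0) < w 0 / 8"
        using i j q by (intro cfl_mult_less[OF lf_speed_pos(2)[OF cell] lf_speed_y_le_max assms(15) ly]) auto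
    qed
    \<comment> \<open>Half of the state balances the source, a quarter the fluxes of each
      direction.\<close>
    have "?U = (1 / 2) *\<^sub>R ?U + (1 / 4) *\<^sub>R ?U + (1 / 4) *\<^sub>R ?U"
      by (simp flip: scaleR_add_left)
    then have "V i1 j1 = ((1 / 2) *\<^sub>R ?U + dt *\<^sub>R source_term dx dy
          (Theta k X FS Ueh i j i1 j1) (Xi k X GS Ueh i j i1 j1) ?U)
        + ((1 / 4) *\<^sub>R ?U
          - (2 * (dt / dx) * (bdry_sign k i1 / w i1)) *\<^sub>R num_flux_x k U i j i1 j1)
        + ((1 / 4) *\<^sub>R ?U
          - (2 * (dt / dy) * (bdry_sign k j1 / w j1)) *\<^sub>R num_flux_y k U i j i1 j1)"
      unfolding V_def by (simp add: algebra_simps)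
    then show ?thesis
      using admissible_add[OF admissible_add[OF src fx] fy] by simp
  qed
  then have "cell_average k w V \<in> admissible"
    by (intro cell_average_admissible gl_weight_pos[OF assms(2)])
  moreover have "cell_average k w (dg_step k X w dx dy dt FS GS Ueh U i j) = cell_average k w V"
    unfolding dg_step_def cell_average_pp_limiter[OF assms(2)] V_def
    by (intro cell_average_forward_euler[OF assms(2,8,9)] cell i j)
  ultimately show "cell_average k w (dg_step k X w dx dy dt FS GS Ueh U i j) \<in> admissible"
    by simp
qed

end
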